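(* Let $K$ be a fixed finite set of integers $\geqslant 2$ with $2\in K$ and $K\neq\{2\}$, and let $l$ be the maximal element of $K$. Then for every $n\geqslant l$ there exists a strongly maximal $K$-antichain $\mathcal A\subseteq 2^{[n]}$ (in particular a maximal $K$-antichain), all of whose members have size $2$ or $l$, such that \[\lvert\mathcal A\rvert=\left(\frac{\lfloor l/2\rfloor\lceil l/2\rceil+1}{4\lfloor l/2\rfloor\lceil l/2\rceil}+O(1/n)\right)n^2 ,\] where the implied constant in $O(1/n)$ depends only on $K$.
   Context: Let $[n]=\{1,\dots,n\}$. A family $\mathcal A\subseteq 2^{[n]}$ is an antichain if $A\not\subseteq B$ for all distinct $A,B\in\mathcal A$. It is a $K$-antichain if moreover $|A|\in K$ for all $A\in\mathcal A$. A $K$-antichain $\mathcal A$ is a maximal $K$-antichain if there is no $K$-antichain $\mathcal A'\subseteq 2^{[n]}$ with $\mathcal A\subsetneq\mathcal A'$; it is strongly maximal if there is no antichain $\mathcal A'\subseteq 2^{[n]}$ (with members of arbitrary sizes) with $\mathcal A\subsetneq\mathcal A'$. *)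

theory Defs
  imports Complex_Main
begin

definition antichain :: "nat \<Rightarrow> nat set set \<Rightarrow> bool" where
  "antichain n \<A> \<longleftrightarrow> \<A> \<subseteq> Pow {1..n} \<and> (\<forall>A\<in>\<A>. \<forall>B\<in>\<A>. A \<noteq> B \<longrightarrow> \<not> A \<subseteq> B)"

definition K_antichain :: "nat set \<Rightarrow> nat \<Rightarrow> nat set set \<Rightarrow> bool" where
  "K_antichain K n \<A> \<longleftrightarrow> antichain n \<A> \<and> (\<forall>A\<in>\<A>. card A \<in> K)"

definition maximal_K_antichain :: "nat set \<Rightarrow> nat \<Rightarrow> nat set set \<Rightarrow> bool" where
  "maximal_K_antichain K n \<A> \<longleftrightarrow>
     K_antichain K n \<A> \<and> (\<nexists>\<A>'. K_antichain K n \<A>' \<and> \<A> \<subset> \<A>')"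

definition strongly_maximal_K_antichain :: "nat set \<Rightarrow> nat \<Rightarrow> nat set set \<Rightarrow> bool" where
  "strongly_maximal_K_antichain K n \<A> \<longleftrightarrow>
     K_antichain K n \<A> \<and> (\<nexists>\<A>'. antichain n \<A>' \<and> \<A> \<subset> \<A>')"

end

theory Submission
  imports Defs
begin

text \<open>
  Put \<open>a = \<lfloor>l/2\<rfloor>\<close>, \<open>b = \<lceil>l/2\<rceil>\<close> and take the graph which is the join of a disjoint union of
  copies of \<open>K\<^sub>a\<close> and a disjoint union of copies of \<open>K\<^sub>b\<close>, each side having about \<open>n/2\<close> vertices;
  fewer than \<open>2ab\<close> vertices remain isolated. The antichain consists of the \<open>l\<close>-cliques together
  with the non-edges. Every clique with at least two vertices lies in an \<open>l\<close>-clique, which makes the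
  antichain strongly maximal. There are \<open>n\<^sup>2/4 + O(n)\<close> non-edges and \<open>(n/2a)(n/2b) + O(n)\<close> cliques.
\<close>

section \<open>A family of cliques completed by the pairs it leaves uncovered\<close>

definition covered_pairs :: "'a set set \<Rightarrow> 'a set set" where
  "covered_pairs \<F> = {S. card S = 2 \<and> (\<exists>F\<in>\<F>. S \<subseteq> F)}"

definition pair_completion :: "nat \<Rightarrow> nat set set \<Rightarrow> nat set set" where
  "pair_completion n \<F> = \<F> \<union> ({S. S \<subseteq> {1..n} \<and> card S = 2} - covered_pairs \<F>)"

text \<open>Conformality in the sense of hypergraph theory: in the graph of covered pairs, every
  clique lies inside a member. Asking for a pair in \<open>X\<close> exempts the empty set and
  single vertices, because vertices may be isolated.\<close>

definition conformal :: "'a set set \<Rightarrow> bool" where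
  "conformal \<F> \<longleftrightarrow> (\<forall>X. (\<exists>S\<subseteq>X. card S = 2) \<and> (\<forall>S\<subseteq>X. card S = 2 \<longrightarrow> S \<in> covered_pairs \<F>)
     \<longrightarrow> (\<exists>F\<in>\<F>. X \<subseteq> F))"

definition joins :: "'a set set \<Rightarrow> 'a set set \<Rightarrow> 'a set set" where
  "joins \<P> \<Q> = (\<lambda>(P, Q). P \<union> Q) ` (\<P> \<times> \<Q>)"

text \<open>Only the sizes 2 and \<open>l\<close> occur, and \<open>l\<close> exceeds 2. A proper
  inclusion would therefore put an uncovered pair inside a member of \<open>\<F>\<close>, which
  covers it.\<close>

lemma antichain_pair_completion:
  assumes F: "\<F> \<subseteq> Pow {1..n}" and l: "\<And>F. F \<in> \<F> \<Longrightarrow> card F = l" "3 \<le> l"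
  shows "antichain n (pair_completion n \<F>)"
proof -
  have sub: "pair_completion n \<F> \<subseteq> Pow {1..n}"
    using F unfolding pair_completion_def by auto
  have fin: "finite B" if "B \<in> pair_completion n \<F>" for B
  proof (rule finite_subset)
    show "B \<subseteq> {1..n}" using that sub by blast
  qed simp
  have "\<not> A \<subseteq> B"
    if A: "A \<in> pair_completion n \<F>" and B: "B \<in> pair_completion n \<F>" and "A \<noteq> B" for A B
  proof
    assume "A \<subseteq> B"
    then have lt: "card A < card B"
      using fin[OF B] \<open>A \<noteq> B\<close> by (simp add: psubset_card_mono psubsetI)
    then have "A \<notin> \<F>" "B \<in> \<F>"
      using A B l unfolding pair_completion_def by auto
    with A \<open>A \<subseteq> B\<close> show False
      unfolding pair_completion_def covered_pairs_def by auto
  qed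
  with sub show ?thesis
    unfolding antichain_def by blast
qed

text \<open>A further member \<open>X\<close> contains no uncovered pair, since such pairs are
  already in the antichain. So \<open>X\<close> is a clique of the covered graph, and conformality
  places it inside a member of \<open>\<F>\<close>, contradicting incomparability.\<close>

lemma pair_completion_maximal:
  assumes con: "conformal \<F>" and n: "2 \<le> n"
    and A: "antichain n \<A>" "pair_completion n \<F> \<subseteq> \<A>"
  shows "\<A> = pair_completion n \<F>"
proof (rule ccontr)
  assume "\<A> \<noteq> pair_completion n \<F>"
  then obtain X where X: "X \<in> \<A>" "X \<notin> pair_completion n \<F>"
    using A by blast
  then have Xn: "X \<subseteq> {1..n}"
    using A unfolding antichain_def by blast
  have incomp: "\<not> X \<subseteq> B" "\<not> B \<subseteq> X" if "B \<in> pair_completion n \<F>" for B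
  proof -
    have "B \<in> \<A>" "B \<noteq> X" using that X A(2) by auto
    with X(1) A(1) show "\<not> X \<subseteq> B" "\<not> B \<subseteq> X" unfolding antichain_def by auto
  qed
  have cov: "S \<in> covered_pairs \<F>" if "S \<subseteq> X" "card S = 2" for S
    using incomp(2)[of S] that Xn unfolding pair_completion_def by auto
  show False
  proof (cases "\<exists>S\<subseteq>X. card S = 2")
    case True
    with cov con obtain F where "F \<in> \<F>" "X \<subseteq> F"
      unfolding conformal_def by meson
    with incomp(1) show False
      unfolding pair_completion_def by auto
  next
    case False
    have "finite X" using Xn finite_subset by auto
    with False have "card X \<le> 2"
      by (metis obtain_subset_with_card_n nat_le_linear)
    \<comment> \<open>An \<open>X\<close> with fewer than two elements has no pair to test. It is
      enlarged to a pair of \<open>{1..n}\<close>, which is either a member itself or covered by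
      one; both contain \<open>X\<close>.\<close>
    with n obtain S where S: "X \<subseteq> S" "S \<subseteq> {1..n}" "card S = 2"
      using exists_subset_between[of X 2 "{1..n}"] Xn by auto
    show False
    proof (cases "S \<in> covered_pairs \<F>")
      case True
      with S obtain F where "F \<in> \<F>" "X \<subseteq> F"
        unfolding covered_pairs_def by auto
      with incomp(1) show False
        unfolding pair_completion_def by auto
    next
      case False
      with S incomp(1)[of S] show False
        unfolding pair_completion_def by auto
    qed
  qed
qed

text \<open>Stated additively, so that no truncated subtraction on \<open>nat\<close>
  arises.\<close>

lemma card_pair_completion:
  assumes F: "\<F> \<subseteq> Pow {1..n}" and l: "\<And>F. F \<in> \<F> \<Longrightarrow> card F = l" "3 \<le> l"
  shows "card (pair_completion n \<F>) + card (covered_pairs \<F>) = card \<F> + (n choose 2)"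
proof -
  let ?T = "{S. S \<subseteq> {1..n} \<and> card S = 2}"
  have finT: "finite ?T" by simp
  have cov: "covered_pairs \<F> \<subseteq> ?T"
    using F unfolding covered_pairs_def by auto
  have "finite \<F>" using F finite_subset by blast
  moreover have "\<F> \<inter> (?T - covered_pairs \<F>) = {}"
    using l by fastforce
  ultimately have "card (pair_completion n \<F>) = card \<F> + card (?T - covered_pairs \<F>)"
    unfolding pair_completion_def using finT by (intro card_Un_disjoint) auto
  moreover have "card (?T - covered_pairs \<F>) + card (covered_pairs \<F>) = card ?T"
    using card_Int_Diff[OF finT, of "covered_pairs \<F>"] cov by (simp add: Int_absorb1)
  moreover have "card ?T = n choose 2"
    using n_subsets[of "{1..n}" 2] by simp
  ultimately show ?thesis by simp
qed

section \<open>Conformality of joins of disjoint blocks\<close>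

text \<open>Two vertices of a clique on the same side must share a block, and blocks on one side are
  disjoint. A clique therefore meets each side within a single block, and the union of these two
  blocks contains it.\<close>

lemma conformal_joins:
  assumes P: "pairwise disjnt \<P>" and Q: "pairwise disjnt \<Q>"
    and PQ: "\<Union>\<P> \<inter> \<Union>\<Q> = {}"
  shows "conformal (joins \<P> \<Q>)"
  unfolding conformal_def
proof (intro allI impI)
  fix X :: "'a set"
  assume "(\<exists>S\<subseteq>X. card S = 2) \<and> (\<forall>S\<subseteq>X. card S = 2 \<longrightarrow> S \<in> covered_pairs (joins \<P> \<Q>))"
  then obtain S where S: "S \<subseteq> X" "card S = 2"
    and cov: "\<And>S. S \<subseteq> X \<Longrightarrow> card S = 2 \<Longrightarrow> S \<in> covered_pairs (joins \<P> \<Q>)"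
    by blast
  obtain u v where uv: "u \<in> X" "v \<in> X" "u \<noteq> v"
    using S by (auto simp: card_2_iff)
  \<comment> \<open>The case \<open>x = y\<close> is included: it puts every single point of
    \<open>X\<close> into a block, by pairing it with whichever of \<open>u\<close>,
    \<open>v\<close> differs from it.\<close>
  have two: "\<exists>P\<in>\<P>. \<exists>Q\<in>\<Q>. x \<in> P \<union> Q \<and> y \<in> P \<union> Q" if "x \<in> X" "y \<in> X" for x y
  proof -
    have *: "\<exists>P\<in>\<P>. \<exists>Q\<in>\<Q>. x \<in> P \<union> Q \<and> y \<in> P \<union> Q" if "x \<in> X" "y \<in> X" "x \<noteq> y" for x y
      using cov[of "{x, y}"] that unfolding covered_pairs_def joins_def by auto
    show ?thesis
      using *[OF that] *[OF \<open>x \<in> X\<close> uv(1)] *[OF \<open>x \<in> X\<close> uv(2)] uv(3) by blast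
  qed
  \<comment> \<open>These serve as default blocks when \<open>X\<close> misses one of the
    sides.\<close>
  obtain P0 Q0 where PQ0: "P0 \<in> \<P>" "Q0 \<in> \<Q>"
    using two uv by blast
  have sameP: "y \<in> P" if xy: "P \<in> \<P>" "x \<in> P" "x \<in> X" "y \<in> X" "y \<in> \<Union>\<P>" for x y P
  proof -
    obtain P' Q' where "P' \<in> \<P>" "Q' \<in> \<Q>" "x \<in> P' \<union> Q'" "y \<in> P' \<union> Q'"
      using two[OF xy(3,4)] by blast
    then have "P' \<in> \<P>" "x \<in> P'" "y \<in> P'"
      using PQ that by auto
    then show ?thesis
      using P that by (metis disjnt_iff pairwiseD)
  qed
  have sameQ: "y \<in> Q" if xy: "Q \<in> \<Q>" "x \<in> Q" "x \<in> X" "y \<in> X" "y \<in> \<Union>\<Q>" for x y Q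
  proof -
    obtain P' Q' where "P' \<in> \<P>" "Q' \<in> \<Q>" "x \<in> P' \<union> Q'" "y \<in> P' \<union> Q'"
      using two[OF xy(3,4)] by blast
    then have "Q' \<in> \<Q>" "x \<in> Q'" "y \<in> Q'"
      using PQ that by auto
    then show ?thesis
      using Q that by (metis disjnt_iff pairwiseD)
  qed
  have "\<exists>P\<in>\<P>. X \<inter> \<Union>\<P> \<subseteq> P"
    using PQ0(1) sameP by (cases "X \<inter> \<Union>\<P> = {}") blast+
  moreover have "\<exists>Q\<in>\<Q>. X \<inter> \<Union>\<Q> \<subseteq> Q"
    using PQ0(2) sameQ by (cases "X \<inter> \<Union>\<Q> = {}") blast+
  ultimately obtain P Q where "P \<in> \<P>" "Q \<in> \<Q>" "X \<inter> \<Union>\<P> \<subseteq> P" "X \<inter> \<Union>\<Q> \<subseteq> Q"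
    by blast
  moreover have "X \<subseteq> \<Union>\<P> \<union> \<Union>\<Q>"
    using two by blast
  ultimately have "P \<union> Q \<in> joins \<P> \<Q>" "X \<subseteq> P \<union> Q"
    unfolding joins_def by blast+
  then show "\<exists>F\<in>joins \<P> \<Q>. X \<subseteq> F" by blast
qed

section \<open>Counting the members and the covered pairs of a join\<close>

text \<open>Intersecting a union with the two sides recovers both blocks, so forming unions is
  injective.\<close>

lemma card_joins:
  assumes PQ: "\<Union>\<P> \<inter> \<Union>\<Q> = {}"
  shows "card (joins \<P> \<Q>) = card \<P> * card \<Q>"
proof -
  have "(P \<union> Q) \<inter> \<Union>\<P> = P" "(P \<union> Q) \<inter> \<Union>\<Q> = Q" if "P \<in> \<P>" "Q \<in> \<Q>" for P Q
    using that PQ by auto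
  then have "inj_on (\<lambda>(P, Q). P \<union> Q) (\<P> \<times> \<Q>)"
    unfolding inj_on_def by (clarsimp, metis)
  then show ?thesis
    unfolding joins_def by (simp add: card_image card_cartesian_product)
qed

lemma card_pairs_in_blocks:
  assumes "finite \<P>" and P: "pairwise disjnt \<P>" and a: "\<And>P. P \<in> \<P> \<Longrightarrow> finite P \<and> card P = a"
  shows "card (covered_pairs \<P>) = card \<P> * (a choose 2)"
proof -
  have "covered_pairs \<P> = (\<Union>P\<in>\<P>. {S. S \<subseteq> P \<and> card S = 2})"
    unfolding covered_pairs_def by auto
  also have "card \<dots> = (\<Sum>P\<in>\<P>. card {S. S \<subseteq> P \<and> card S = 2})"
  proof (rule card_UN_disjoint)
    show "\<forall>i\<in>\<P>. \<forall>j\<in>\<P>. i \<noteq> j \<longrightarrow>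
        {S. S \<subseteq> i \<and> card S = 2} \<inter> {S. S \<subseteq> j \<and> card S = 2} = {}"
    proof (intro ballI impI equals0I)
      fix i j S assume "i \<in> \<P>" "j \<in> \<P>" "i \<noteq> j"
        and S: "S \<in> {S. S \<subseteq> i \<and> card S = 2} \<inter> {S. S \<subseteq> j \<and> card S = 2}"
      then have "i \<inter> j = {}"
        using P by (auto simp: pairwise_def disjnt_def)
      with S have "S = {}" by blast
      with S show False by simp
    qed
  qed (use assms in auto)
  also have "\<dots> = (\<Sum>P\<in>\<P>. a choose 2)"
    using a by (intro sum.cong) (auto simp: n_subsets)
  finally show ?thesis by simp
qed

lemma card_cross_pairs:
  assumes "U \<inter> V = {}"
  shows "card ((\<lambda>(x, y). {x, y}) ` (U \<times> V)) = card U * card V"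
proof -
  have "inj_on (\<lambda>(x, y). {x, y}) (U \<times> V)"
    using assms by (auto simp: inj_on_def doubleton_eq_iff)
  then show ?thesis
    by (simp add: card_image card_cartesian_product)
qed

text \<open>The condition \<open>ne\<close> guards against a degenerate case: if just one family is
  empty, the join is empty and covers nothing, while the other family may still cover pairs.\<close>

lemma covered_pairs_joins:
  assumes PQ: "\<Union>\<P> \<inter> \<Union>\<Q> = {}" and ne: "\<P> = {} \<longleftrightarrow> \<Q> = {}"
  shows "covered_pairs (joins \<P> \<Q>) =
    covered_pairs \<P> \<union> covered_pairs \<Q> \<union> (\<lambda>(x, y). {x, y}) ` (\<Union>\<P> \<times> \<Union>\<Q>)"
    (is "_ = ?R")
proof
  show "covered_pairs (joins \<P> \<Q>) \<subseteq> ?R"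
  proof
    fix S assume "S \<in> covered_pairs (joins \<P> \<Q>)"
    then obtain P Q where S: "card S = 2" "P \<in> \<P>" "Q \<in> \<Q>" "S \<subseteq> P \<union> Q"
      unfolding covered_pairs_def joins_def by auto
    then obtain x y where xy: "S = {x, y}" by (auto simp: card_2_iff)
    consider "x \<in> P \<and> y \<in> P" | "x \<in> Q \<and> y \<in> Q" | "x \<in> P \<and> y \<in> Q" | "x \<in> Q \<and> y \<in> P"
      using S xy by blast
    then show "S \<in> ?R"
    proof cases
      case 4
      with S xy have "S = {y, x}" "(y, x) \<in> \<Union>\<P> \<times> \<Union>\<Q>" by auto
      then show ?thesis by blast
    qed (use S xy in \<open>auto simp: covered_pairs_def\<close>)
  qed
  show "?R \<subseteq> covered_pairs (joins \<P> \<Q>)"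
  proof
    fix S assume "S \<in> ?R"
    then consider "S \<in> covered_pairs \<P>" | "S \<in> covered_pairs \<Q>"
      | x y where "S = {x, y}" "x \<in> \<Union>\<P>" "y \<in> \<Union>\<Q>" by auto
    then have "card S = 2 \<and> (\<exists>P\<in>\<P>. \<exists>Q\<in>\<Q>. S \<subseteq> P \<union> Q)"
    proof cases
      case 3
      then have "x \<noteq> y" using PQ by auto
      with 3 show ?thesis by auto
    qed (use ne in \<open>auto simp: covered_pairs_def\<close>)
    then show "S \<in> covered_pairs (joins \<P> \<Q>)"
      unfolding covered_pairs_def joins_def by auto
  qed
qed

lemma card_covered_pairs_joins:
  assumes fin: "finite \<P>" "finite \<Q>"
    and P: "pairwise disjnt \<P>" "\<And>P. P \<in> \<P> \<Longrightarrow> finite P \<and> card P = a"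
    and Q: "pairwise disjnt \<Q>" "\<And>Q. Q \<in> \<Q> \<Longrightarrow> finite Q \<and> card Q = b"
    and PQ: "\<Union>\<P> \<inter> \<Union>\<Q> = {}" and ne: "\<P> = {} \<longleftrightarrow> \<Q> = {}"
  shows "card (covered_pairs (joins \<P> \<Q>)) =
    card \<P> * (a choose 2) + card \<Q> * (b choose 2) + card (\<Union>\<P>) * card (\<Union>\<Q>)"
proof -
  let ?X = "(\<lambda>(x, y). {x, y}) ` (\<Union>\<P> \<times> \<Union>\<Q>)"
  have finite_cov: "finite (covered_pairs \<R>)" if "finite \<R>" "\<And>R. R \<in> \<R> \<Longrightarrow> finite R"
    for \<R> :: "'a set set"
    by (rule finite_subset[of _ "Pow (\<Union>\<R>)"]) (use that in \<open>auto simp: covered_pairs_def\<close>)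
  have finP: "finite (covered_pairs \<P>)" and finQ: "finite (covered_pairs \<Q>)"
    using finite_cov fin P(2) Q(2) by auto
  have finX: "finite ?X" using fin P(2) Q(2) by auto
  \<comment> \<open>Nonemptiness matters: disjointness of the two sides only excludes a common
    nonempty set.\<close>
  have in_Un: "S \<subseteq> \<Union>\<R> \<and> S \<noteq> {}" if "S \<in> covered_pairs \<R>" for S and \<R> :: "'a set set"
    using that unfolding covered_pairs_def by auto
  have d1: "covered_pairs \<P> \<inter> covered_pairs \<Q> = {}"
    using in_Un PQ by blast
  have d2: "(covered_pairs \<P> \<union> covered_pairs \<Q>) \<inter> ?X = {}"
    using in_Un PQ by blast
  show ?thesis
    using covered_pairs_joins[OF PQ ne] d1 d2 finP finQ finX
      card_pairs_in_blocks[OF fin(1) P] card_pairs_in_blocks[OF fin(2) Q] card_cross_pairs[OF PQ]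
    by (simp add: card_Un_disjoint)
qed

section \<open>Realising the graph on \<open>{1..n}\<close>\<close>

text \<open>Blocks are consecutive intervals of length \<open>a\<close>. The offset \<open>s\<close>
  allows the two sides of the join to be laid out one after the other.\<close>

lemma interval_blocks:
  fixes a k s :: nat
  assumes "0 < a"
  obtains \<P> where "finite \<P>" "card \<P> = k" "pairwise disjnt \<P>" "\<Union>\<P> = {s<..s + a * k}"
    "\<And>P. P \<in> \<P> \<Longrightarrow> finite P \<and> card P = a"
proof -
  have "\<exists>\<P>. finite \<P> \<and> card \<P> = k \<and> pairwise disjnt \<P> \<and> \<Union>\<P> = {s<..s + a * k} \<and>
    (\<forall>P\<in>\<P>. finite P \<and> card P = a)"
  proof (induction k)
    case 0
    show ?case by (intro exI[of _ "{}"]) auto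
  next
    case (Suc k)
    then obtain \<P> where \<P>: "finite \<P>" "card \<P> = k" "pairwise disjnt \<P>"
      "\<Union>\<P> = {s<..s + a * k}" "\<forall>P\<in>\<P>. finite P \<and> card P = a" by blast
    let ?B = "{s + a * k<..s + a * k + a}"
    have disj: "disjnt ?B P" if "P \<in> \<P>" for P
    proof -
      have "P \<subseteq> {s<..s + a * k}" using that \<P>(4) by blast
      then show ?thesis unfolding disjnt_def by fastforce
    qed
    \<comment> \<open>An empty block would be disjoint from itself; being nonempty is what makes the
      new block distinct from the old ones, so that the count grows by one.\<close>
    have "?B \<noteq> {}" using assms by auto
    then have "?B \<notin> \<P>" using disj by (metis disjnt_self_iff_empty)
    moreover have "pairwise disjnt (insert ?B \<P>)"
      using \<P>(3) disj by (auto simp: pairwise_insert disjnt_sym)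
    moreover have "\<Union>(insert ?B \<P>) = {s<..s + a * Suc k}"
      using \<P>(4) by auto
    ultimately show ?case
      using \<P> by (intro exI[of _ "insert ?B \<P>"]) auto
  qed
  then show thesis using that by blast
qed

lemma real_choose_two: "real (n choose 2) = real n * (real n - 1) / 2"
  by (cases n) (auto simp: choose_two real_of_nat_div field_simps)

text \<open>Taking \<open>b * m\<close> blocks of size \<open>a\<close> and \<open>a * m\<close>
  blocks of size \<open>b\<close> gives both sides exactly \<open>a * b * m\<close> vertices. The
  final equation is the count of members plus covered pairs, with the covered pairs split into those
  inside blocks of either side and the \<open>(a * b * m)\<^sup>2\<close> crossing pairs.\<close>

lemma join_construction:
  fixes a b m n :: nat
  assumes a: "0 < a" and b: "0 < b" and l: "3 \<le> a + b" and n: "2 * a * b * m \<le> n" "2 \<le> n"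
  obtains \<A> where "antichain n \<A>" "\<And>\<A>'. antichain n \<A>' \<Longrightarrow> \<A> \<subseteq> \<A>' \<Longrightarrow> \<A>' = \<A>"
    "\<And>A. A \<in> \<A> \<Longrightarrow> card A = 2 \<or> card A = a + b"
    "card \<A> + (b * m * (a choose 2) + a * m * (b choose 2) + (a * b * m)\<^sup>2)
      = a * b * m\<^sup>2 + (n choose 2)"
proof -
  obtain \<P> where P: "finite \<P>" "card \<P> = b * m" "pairwise disjnt \<P>"
    "\<Union>\<P> = {0<..0 + a * (b * m)}" "\<And>P. P \<in> \<P> \<Longrightarrow> finite P \<and> card P = a"
    using interval_blocks[OF a] by metis
  obtain \<Q> where Q: "finite \<Q>" "card \<Q> = a * m" "pairwise disjnt \<Q>"
    "\<Union>\<Q> = {a * b * m<..a * b * m + b * (a * m)}" "\<And>Q. Q \<in> \<Q> \<Longrightarrow> finite Q \<and> card Q = b"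
    using interval_blocks[OF b] by metis
  let ?F = "joins \<P> \<Q>"
  have PQ: "\<Union>\<P> \<inter> \<Union>\<Q> = {}"
    unfolding P(4) Q(4) by auto
  \<comment> \<open>For \<open>m = 0\<close> both families are empty; otherwise neither is, as
    \<open>a\<close> and \<open>b\<close> are positive.\<close>
  have "\<P> = {} \<longleftrightarrow> card \<P> = 0" "\<Q> = {} \<longleftrightarrow> card \<Q> = 0"
    using P(1) Q(1) by auto
  then have ne: "\<P> = {} \<longleftrightarrow> \<Q> = {}"
    using P(2) Q(2) a b by simp
  have "\<Union>\<P> \<subseteq> {1..n}" "\<Union>\<Q> \<subseteq> {1..n}"
    unfolding P(4) Q(4) using n(1) by (auto simp: algebra_simps)
  then have F: "?F \<subseteq> Pow {1..n}"
    unfolding joins_def by auto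
  have cardF: "card F = a + b" if FF: "F \<in> ?F" for F
  proof -
    obtain R S where RS: "R \<in> \<P>" "S \<in> \<Q>" "F = R \<union> S"
      using FF unfolding joins_def by auto
    moreover have "R \<inter> S = {}" using RS PQ by blast
    ultimately show ?thesis using P(5) Q(5) by (simp add: card_Un_disjoint)
  qed
  show thesis
  proof
    show "antichain n (pair_completion n ?F)"
      using F cardF l by (rule antichain_pair_completion)
    show "\<A>' = pair_completion n ?F" if "antichain n \<A>'" "pair_completion n ?F \<subseteq> \<A>'" for \<A>'
      using pair_completion_maximal[OF conformal_joins[OF P(3) Q(3) PQ] n(2) that] .
    show "card A = 2 \<or> card A = a + b" if "A \<in> pair_completion n ?F" for A
      using that cardF unfolding pair_completion_def by auto
    have "card (covered_pairs ?F)
        = b * m * (a choose 2) + a * m * (b choose 2) + (a * b * m)\<^sup>2"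
      using card_covered_pairs_joins[OF P(1) Q(1) P(3,5) Q(3,5) PQ ne] P(2,4) Q(2,4)
      by (simp add: power2_eq_square algebra_simps)
    moreover have "card ?F = a * b * m\<^sup>2"
      using card_joins[OF PQ] P(2) Q(2) by (simp add: power2_eq_square)
    ultimately show "card (pair_completion n ?F)
        + (b * m * (a choose 2) + a * m * (b choose 2) + (a * b * m)\<^sup>2) = a * b * m\<^sup>2 + (n choose 2)"
      using card_pair_completion[OF F cardF l] by simp
  qed
qed

section \<open>Asymptotics of the size\<close>

text \<open>With \<open>d = a * b\<close> and \<open>N = 2 * d * m\<close> non-isolated vertices,
  there are \<open>N\<^sup>2 / (4 * d)\<close> cliques and \<open>N\<^sup>2 / 4\<close> crossing
  pairs. Up to linear terms the error is \<open>(n\<^sup>2 - N\<^sup>2) * (d - 1) / (4 * d)\<close>,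
  which is itself linear in \<open>n\<close> because \<open>n - N\<close> is at most
  \<open>2 * d\<close>.\<close>

lemma join_size_estimate:
  fixes a b m n c :: nat
  assumes a: "0 < a" and b: "0 < b" and m: "m = n div (2 * a * b)"
    and c: "c + (b * m * (a choose 2) + a * m * (b choose 2) + (a * b * m)\<^sup>2)
      = a * b * m\<^sup>2 + (n choose 2)"
  shows "\<bar>real c - (real (a * b) + 1) / (4 * real (a * b)) * (real n)\<^sup>2\<bar>
    \<le> (1 + real (a * b) + real (a + b)) * real n"
proof -
  define d where "d = real (a * b)"
  define N where "N = 2 * d * real m"
  have d: "1 \<le> d" using a b unfolding d_def by (simp add: Suc_leI flip: of_nat_mult)
  have "n = 2 * a * b * m + n mod (2 * a * b)" "n mod (2 * a * b) < 2 * a * b"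
    using a b m by simp_all
  then have "real n = N + real (n mod (2 * a * b))" "real (n mod (2 * a * b)) \<le> 2 * d"
    unfolding N_def d_def by (metis of_nat_add of_nat_mult of_nat_numeral mult.assoc,
        metis less_imp_le mult.assoc of_nat_le_iff of_nat_mult of_nat_numeral)
  then have N: "0 \<le> N" "N \<le> real n" "real n - N \<le> 2 * d"
    using d unfolding N_def by auto
  have "real c + (real b * real m * (real a * (real a - 1) / 2)
      + real a * real m * (real b * (real b - 1) / 2) + (d * real m)\<^sup>2)
      = d * (real m)\<^sup>2 + real n * (real n - 1) / 2"
    using arg_cong[OF c, of real] by (simp add: real_choose_two d_def)
  then have c': "real c = d * (real m)\<^sup>2 + real n * (real n - 1) / 2
      - d * real m * (real (a + b) - 2) / 2 - (d * real m)\<^sup>2"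
    by (simp add: d_def field_simps)
  \<comment> \<open>With a name for \<open>1 / (4 * d)\<close>, the identity for the error becomes
    polynomial; \<open>4 * d * e = 1\<close> enters only through
    \<open>N\<^sup>2 * e = d * (real m)\<^sup>2\<close>.\<close>
  define e where "e = 1 / (4 * d)"
  have e: "(d + 1) / (4 * d) = 1 / 4 + e" "(d - 1) / (4 * d) = 1 / 4 - e" "4 * d * e = 1"
    using d unfolding e_def by (simp_all add: field_simps)
  have "N\<^sup>2 * e = d * (real m)\<^sup>2 * (4 * d * e)"
    unfolding N_def by (simp add: power2_eq_square)
  then have "N\<^sup>2 * e = d * (real m)\<^sup>2"
    unfolding e(3) by simp
  then have eq: "real c - (d + 1) / (4 * d) * (real n)\<^sup>2
      = (real n - N) * (real n + N) * ((d - 1) / (4 * d)) - real n / 2 - N * (real (a + b) - 2) / 4"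
    unfolding e c' N_def by (simp add: field_simps power2_eq_square)
  have "0 \<le> (real n - N) * (real n + N)"
    using N by simp
  moreover have "(real n - N) * (real n + N) \<le> (2 * d) * (2 * real n)"
    by (rule mult_mono) (use N d in auto)
  moreover have "0 \<le> (d - 1) / (4 * d)" "(d - 1) / (4 * d) \<le> 1 / 4"
    using d by (auto simp: field_simps)
  ultimately have "0 \<le> (real n - N) * (real n + N) * ((d - 1) / (4 * d))"
    "(real n - N) * (real n + N) * ((d - 1) / (4 * d)) \<le> (2 * d) * (2 * real n) * (1 / 4)"
    using N d by (auto intro!: mult_mono mult_nonneg_nonneg simp del: times_divide_eq_right)
  moreover have "2 \<le> real (a + b)" using a b by linarith
  then have "0 \<le> N * (real (a + b) - 2)" "N * (real (a + b) - 2) \<le> real n * real (a + b)"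
    using N by (auto intro!: mult_mono simp del: of_nat_add)
  \<comment> \<open>Here \<open>x\<close> and \<open>y\<close> stand for the two nonlinear products
    of \<open>eq\<close>; with them generalised, the bound is linear arithmetic.\<close>
  moreover have "\<bar>x - real n / 2 - y / 4\<bar> \<le> (1 + d + real (a + b)) * real n"
    if "0 \<le> x" "x \<le> (2 * d) * (2 * real n) * (1 / 4)" "0 \<le> y" "y \<le> real n * real (a + b)"
    for x y
  proof -
    have "(1 + d + real (a + b)) * real n = real n + d * real n + real n * real (a + b)"
      by (simp add: algebra_simps)
    moreover have "(2 * d) * (2 * real n) * (1 / 4) = d * real n" by simp
    ultimately show ?thesis using that by linarith
  qed
  ultimately show ?thesis
    unfolding d_def[symmetric] eq by blast
qed

section \<open>The balanced split of \<open>l\<close> and the relative error\<close>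

theorem mainTheorem3:
  fixes K :: "nat set" and l :: nat
  assumes "finite K" and "\<forall>k\<in>K. 2 \<le> k" and "2 \<in> K" and "K \<noteq> {2}" and "l = Max K"
  shows "\<exists>C::real. \<forall>n\<ge>l. \<exists>\<A>.
           strongly_maximal_K_antichain K n \<A> \<and> maximal_K_antichain K n \<A> \<and>
           (\<forall>A\<in>\<A>. card A = 2 \<or> card A = l) \<and>
           (\<exists>\<epsilon>::real. \<bar>\<epsilon>\<bar> \<le> C * (1 / real n) \<and>
              real (card \<A>) =
                ((of_int (\<lfloor>real l / 2\<rfloor> * \<lceil>real l / 2\<rceil>) + 1) /
                 (4 * of_int (\<lfloor>real l / 2\<rfloor> * \<lceil>real l / 2\<rceil>)) + \<epsilon>) * (real n)\<^sup>2)"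
proof -
  obtain k where "k \<in> K" "k \<noteq> 2" using assms(3,4) by blast
  then have "3 \<le> k" using assms(2) by fastforce
  with \<open>k \<in> K\<close> have l3: "3 \<le> l" using assms(1,5) Max_ge le_trans by metis
  have lK: "l \<in> K" using assms(1,3,5) Max_in by blast
  define a b where "a = l div 2" and "b = l - l div 2"
  have ab: "0 < a" "0 < b" "a + b = l" using l3 unfolding a_def b_def by auto
  have fl: "\<lfloor>real l / 2\<rfloor> = int a"
    unfolding a_def using floor_divide_of_nat_eq[of l 2] by simp
  have "\<lceil>real l / 2\<rceil> = int b"
    unfolding b_def by (intro ceiling_unique) linarith+
  with fl have fc: "real_of_int (\<lfloor>real l / 2\<rfloor> * \<lceil>real l / 2\<rceil>) = real (a * b)"
    by simp
  \<comment> \<open>The constant depends on \<open>a\<close> and \<open>b\<close> alone, hence only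
    on \<open>l\<close>, and so only on \<open>K\<close>.\<close>
  let ?C = "1 + real (a * b) + real (a + b)"
  let ?L = "(real (a * b) + 1) / (4 * real (a * b))"
  show ?thesis
    unfolding fc
  proof (intro exI[of _ ?C] allI impI)
    fix n assume "l \<le> n"
    \<comment> \<open>The largest \<open>m\<close> for which the graph fits into
      \<open>{1..n}\<close>. For small \<open>n\<close> it may be 0, in which case the antichain
      consists of all pairs.\<close>
    define m where "m = n div (2 * a * b)"
    have n: "2 * a * b * m \<le> n" "2 \<le> n" "3 \<le> a + b"
      using \<open>l \<le> n\<close> l3 ab(3) unfolding m_def by auto
    obtain \<A> where anti: "antichain n \<A>"
      and max: "\<And>\<A>'. antichain n \<A>' \<Longrightarrow> \<A> \<subseteq> \<A>' \<Longrightarrow> \<A>' = \<A>"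
      and sizes: "\<And>A. A \<in> \<A> \<Longrightarrow> card A = 2 \<or> card A = a + b"
      and size: "card \<A> + (b * m * (a choose 2) + a * m * (b choose 2) + (a * b * m)\<^sup>2)
        = a * b * m\<^sup>2 + (n choose 2)"
      using join_construction[OF ab(1,2) n(3,1,2)] by metis
    have KA: "K_antichain K n \<A>"
      using anti sizes assms(3) lK ab(3) unfolding K_antichain_def by metis
    \<comment> \<open>Defined as the exact deviation divided by \<open>n\<^sup>2\<close>, so that
      the size formula holds by construction; the linear bound on the deviation then becomes
      \<open>?C / n\<close>.\<close>
    define \<epsilon> where "\<epsilon> = (real (card \<A>) - ?L * (real n)\<^sup>2) / (real n)\<^sup>2"
    have n0: "0 < real n" using n by simp
    have "\<bar>\<epsilon>\<bar> \<le> ?C * real n / (real n)\<^sup>2"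
      unfolding \<epsilon>_def abs_divide using join_size_estimate[OF ab(1,2) m_def size]
      by (simp add: divide_right_mono)
    also have "\<dots> = ?C * (1 / real n)"
      using n0 by (simp add: power2_eq_square)
    finally have "\<bar>\<epsilon>\<bar> \<le> ?C * (1 / real n)" .
    moreover have "real (card \<A>) = (?L + \<epsilon>) * (real n)\<^sup>2"
      using n0 unfolding \<epsilon>_def by (simp add: distrib_right)
    moreover have "strongly_maximal_K_antichain K n \<A>"
      unfolding strongly_maximal_K_antichain_def using KA max by blast
    moreover have "maximal_K_antichain K n \<A>"
      unfolding maximal_K_antichain_def using KA max K_antichain_def by blast
    ultimately show "\<exists>\<A>. strongly_maximal_K_antichain K n \<A> \<and> maximal_K_antichain K n \<A> \<and>
        (\<forall>A\<in>\<A>. card A = 2 \<or> card A = l) \<and>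
        (\<exists>\<epsilon>. \<bar>\<epsilon>\<bar> \<le> ?C * (1 / real n) \<and> real (card \<A>) = (?L + \<epsilon>) * (real n)\<^sup>2)"
      using sizes ab(3) by (intro exI[of _ \<A>] conjI exI[of _ \<epsilon>]) auto
  qed
qed

end
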